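(* Let $n\ge1$. For each $1\le k\le n$, $(\bigwedge^kM[D_n],D_t)$ is a $\mathbb{Z}[D_n]$-intersection pair generated by $\epsilon^1\wedge\cdots\wedge\epsilon^k$ (i.e. with fundamental element $\epsilon^1\wedge\cdots\wedge\epsilon^k$).
   Context: $M=\bigoplus_{i\ge1}\mathbb{Z}\epsilon^i$ is the free $\mathbb{Z}$-module with basis $(\epsilon^1,\epsilon^2,\ldots)$, with endomorphisms $D_j\epsilon^i=\epsilon^{i+j}$ ($j\ge0$). $M[D_n]$ denotes $M$ regarded as a module over the polynomial ring $\mathbb{Z}[D_n]$, the variable acting as the shift $\epsilon^i\mapsto\epsilon^{i+n}$; it is free of rank $n$ with basis $\epsilon^1,\ldots,\epsilon^n$, and the $D_j$ are $\mathbb{Z}[D_n]$-linear. Exterior powers of $M[D_n]$ are over $\mathbb{Z}[D_n]$. $D_t=\sum_{j\ge0}D_jt^j$ is extended to $\bigwedge M[D_n]\to(\bigwedge M[D_n])[[t]]$ by requiring it to be a $\mathbb{Z}[D_n]$-algebra homomorphism, $D_t(\alpha\wedge\beta)=D_t\alpha\wedge D_t\beta$; its coefficients $D_j$ act on $\bigwedge^kM[D_n]$. For a base ring $A$ (a Noetherian integral domain), an $A$-intersection pair is a free $A$-module $N$ together with a sequence $(D_0,D_1,\ldots)$ of pairwise commuting $A$-endomorphisms of $N$ such that for some $m_0\in N$, called a fundamental element, the map $A[T_1,T_2,\ldots]\to N$, $P\mapsto P(D_1,D_2,\ldots)m_0$, is surjective. *)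

theory Defs
  imports
    "HOL-Library.Poly_Mapping"
    "HOL-Library.Cardinality"
    "HOL-Computational_Algebra.Polynomial"
    "HOL-Computational_Algebra.Formal_Power_Series"
begin

section \<open>Intersection pairs\<close>

definition noetherian :: "'a::comm_ring_1 itself \<Rightarrow> bool" where
  "noetherian _ \<longleftrightarrow>
     (\<forall>I::'a set. module.subspace (*) I \<longrightarrow> (\<exists>F. finite F \<and> I = module.span (*) F))"

definition free_submodule ::
  "('a::comm_ring_1 \<Rightarrow> 'b::ab_group_add \<Rightarrow> 'b) \<Rightarrow> 'b set \<Rightarrow> bool" where
  "free_submodule scale N \<longleftrightarrow>
     (\<exists>B. \<not> module.dependent scale B \<and> module.span scale B = N)"

definition linear_endo_on ::
  "('a::comm_ring_1 \<Rightarrow> 'b::ab_group_add \<Rightarrow> 'b) \<Rightarrow> 'b set \<Rightarrow> ('b \<Rightarrow> 'b) \<Rightarrow> bool" where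
  "linear_endo_on scale N f \<longleftrightarrow>
     f ` N \<subseteq> N \<and> (\<forall>x\<in>N. \<forall>y\<in>N. f (x + y) = f x + f y) \<and> (\<forall>a. \<forall>x\<in>N. f (scale a x) = scale a (f x))"

text \<open>Polynomials in infinitely many variables over a ring \<open>'a\<close> are elements of
  \<open>(nat \<Rightarrow>\<^sub>0 nat) \<Rightarrow>\<^sub>0 'a\<close>. The variable with number \<open>i\<close> stands for $T_{i+1}$, so \<open>D 0\<close> is never
  substituted. The endomorphisms of an intersection pair commute, so the order in which the
  powers are composed does not matter there.\<close>

definition monomial_op :: "(nat \<Rightarrow> 'b \<Rightarrow> 'b) \<Rightarrow> (nat \<Rightarrow>\<^sub>0 nat) \<Rightarrow> 'b \<Rightarrow> 'b" where
  "monomial_op D \<mu> =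
     foldr (\<lambda>i f. (D (Suc i) ^^ Poly_Mapping.lookup \<mu> i) \<circ> f)
       (sorted_list_of_set (Poly_Mapping.keys \<mu>)) id"

definition poly_op ::
  "('a::comm_ring_1 \<Rightarrow> 'b::ab_group_add \<Rightarrow> 'b) \<Rightarrow> (nat \<Rightarrow> 'b \<Rightarrow> 'b) \<Rightarrow>
   ((nat \<Rightarrow>\<^sub>0 nat) \<Rightarrow>\<^sub>0 'a) \<Rightarrow> 'b \<Rightarrow> 'b" where
  "poly_op scale D P x =
     (\<Sum>\<mu>\<in>Poly_Mapping.keys P. scale (Poly_Mapping.lookup P \<mu>) (monomial_op D \<mu> x))"

definition fundamental_element ::
  "('a::comm_ring_1 \<Rightarrow> 'b::ab_group_add \<Rightarrow> 'b) \<Rightarrow> 'b set \<Rightarrow> (nat \<Rightarrow> 'b \<Rightarrow> 'b) \<Rightarrow> 'b \<Rightarrow> bool" where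
  "fundamental_element scale N D m0 \<longleftrightarrow>
     m0 \<in> N \<and> range (\<lambda>P. poly_op scale D P m0) = N"

definition intersection_pair ::
  "('a::idom \<Rightarrow> 'b::ab_group_add \<Rightarrow> 'b) \<Rightarrow> 'b set \<Rightarrow> (nat \<Rightarrow> 'b \<Rightarrow> 'b) \<Rightarrow> bool" where
  "intersection_pair scale N D \<longleftrightarrow>
     noetherian TYPE('a) \<and>
     module scale \<and>
     free_submodule scale N \<and>
     (\<forall>j. linear_endo_on scale N (D j)) \<and>
     (\<forall>i j. \<forall>x\<in>N. D i (D j x) = D j (D i x)) \<and>
     (\<exists>m0. fundamental_element scale N D m0)"


section \<open>The exterior algebra of a module over the integer polynomials\<close>

class int_poly_module = ab_group_add +
  fixes pscale :: "int poly \<Rightarrow> 'a \<Rightarrow> 'a"  (infixr \<open>\<odot>\<close> 75)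
  assumes pscale_add_right: "r \<odot> (x + y) = r \<odot> x + r \<odot> y"
    and pscale_add_left: "(r + s) \<odot> x = r \<odot> x + s \<odot> x"
    and pscale_pscale: "r \<odot> (s \<odot> x) = (r * s) \<odot> x"
    and pscale_one: "1 \<odot> x = x"

lemma module_pscale: "module (pscale :: int poly \<Rightarrow> 'a::int_poly_module \<Rightarrow> 'a)"
  by standard (simp_all add: pscale_add_right pscale_add_left pscale_pscale pscale_one)

text \<open>Words under concatenation, so that \<open>'m list \<Rightarrow>\<^sub>0 int poly\<close> is the free associative algebra
  on the set \<open>'m\<close>.\<close>

instantiation list :: (type) monoid_add
begin
definition zero_list :: "'a list" where "zero_list = []"
definition plus_list :: "'a list \<Rightarrow> 'a list \<Rightarrow> 'a list" where "plus_list xs ys = xs @ ys"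
instance by standard (simp_all add: zero_list_def plus_list_def)
end

abbreviation (input) word :: "'m list \<Rightarrow> ('m list \<Rightarrow>\<^sub>0 int poly)" where
  "word w \<equiv> Poly_Mapping.single w 1"

abbreviation (input) const :: "int poly \<Rightarrow> ('m list \<Rightarrow>\<^sub>0 int poly)" where
  "const r \<equiv> Poly_Mapping.single [] r"

text \<open>The congruence of the free algebra generated by the linear relations, which cut it down to
  the tensor algebra, and by the relations $m \otimes m = 0$.\<close>

inductive ext_cong ::
  "('m::int_poly_module list \<Rightarrow>\<^sub>0 int poly) \<Rightarrow> ('m list \<Rightarrow>\<^sub>0 int poly) \<Rightarrow> bool" where
  add: "ext_cong (word [m + m']) (word [m] + word [m'])"
| scale: "ext_cong (word [r \<odot> m]) (const r * word [m])"
| square: "ext_cong (word [m] * word [m]) 0"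
| refl: "ext_cong x x"
| sym: "ext_cong x y \<Longrightarrow> ext_cong y x"
| trans: "ext_cong x y \<Longrightarrow> ext_cong y z \<Longrightarrow> ext_cong x z"
| plus: "ext_cong x x' \<Longrightarrow> ext_cong y y' \<Longrightarrow> ext_cong (x + y) (x' + y')"
| times: "ext_cong x x' \<Longrightarrow> ext_cong y y' \<Longrightarrow> ext_cong (x * y) (x' * y')"

lemma ext_cong_uminus: "ext_cong x y \<Longrightarrow> ext_cong (- x) (- y)"
  using ext_cong.times[OF ext_cong.refl, of x y "- 1"] by simp

lemma lookup_times_Nil:
  "Poly_Mapping.lookup (x * y) [] =
     Poly_Mapping.lookup x [] * (Poly_Mapping.lookup y [] :: int poly)"
proof -
  have *: "([] = l + q) = (l = [] \<and> q = [])" for l q :: "'a list"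
    by (auto simp: plus_list_def)
  have "Sum_any (\<lambda>q. Poly_Mapping.lookup y q when [] = l + q) = (Poly_Mapping.lookup y [] when l = [])" for l
    by (cases "l = []") (simp_all add: *)
  then show ?thesis
    unfolding lookup_mult by (simp add: mult_when)
qed

lemma ext_cong_lookup_Nil:
  "ext_cong x y \<Longrightarrow> Poly_Mapping.lookup x [] = Poly_Mapping.lookup y []"
  by (induction rule: ext_cong.induct)
    (simp_all add: lookup_times_Nil lookup_add lookup_single)

quotient_type (overloaded) 'm exterior = "'m::int_poly_module list \<Rightarrow>\<^sub>0 int poly" / ext_cong
  by (rule equivpI)
    (auto intro!: reflpI sympI transpI intro: ext_cong.refl ext_cong.sym ext_cong.trans)

text \<open>The product of the ring \<open>'m exterior\<close> is the wedge product.\<close>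

instantiation exterior :: (int_poly_module) ring_1
begin

lift_definition zero_exterior :: "'a exterior" is 0 .
lift_definition one_exterior :: "'a exterior" is 1 .
lift_definition plus_exterior :: "'a exterior \<Rightarrow> 'a exterior \<Rightarrow> 'a exterior" is "(+)"
  by (rule ext_cong.plus)
lift_definition uminus_exterior :: "'a exterior \<Rightarrow> 'a exterior" is uminus
  by (rule ext_cong_uminus)
lift_definition minus_exterior :: "'a exterior \<Rightarrow> 'a exterior \<Rightarrow> 'a exterior" is "(-)"
  by (metis ext_cong.plus ext_cong_uminus diff_conv_add_uminus)
lift_definition times_exterior :: "'a exterior \<Rightarrow> 'a exterior \<Rightarrow> 'a exterior" is "(*)"
  by (rule ext_cong.times)

instance
proof
  show "(0::'a exterior) \<noteq> 1"
  proof (transfer, rule notI)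
    assume "ext_cong (0::'a list \<Rightarrow>\<^sub>0 int poly) 1"
    from ext_cong_lookup_Nil[OF this] show False
      by (simp add: lookup_one zero_list_def)
  qed
next
  fix a b c :: "'a exterior"
  show "a + b + c = a + (b + c)" "a + b = b + a" "0 + a = a" "- a + a = 0" "a - b = a + - b"
    "a * b * c = a * (b * c)" "1 * a = a" "a * 1 = a"
    "(a + b) * c = a * c + b * c" "a * (b + c) = a * b + a * c"
    by (transfer; simp add: algebra_simps ext_cong.refl)+
qed

end

instantiation exterior :: (int_poly_module) int_poly_module
begin

lift_definition pscale_exterior :: "int poly \<Rightarrow> 'a exterior \<Rightarrow> 'a exterior" is
  "\<lambda>r x. const r * x"
  by (rule ext_cong.times[OF ext_cong.refl])

instance
proof
  fix r s :: "int poly" and x y :: "'a exterior"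
  show "r \<odot> (x + y) = r \<odot> x + r \<odot> y" "(r + s) \<odot> x = r \<odot> x + s \<odot> x"
    "r \<odot> (s \<odot> x) = (r * s) \<odot> x" "1 \<odot> x = x"
    by (transfer; simp add: distrib_left distrib_right ext_cong.refl single_add mult_single
      mult.assoc[symmetric] zero_list_def[symmetric])+
qed

end

lift_definition \<iota> :: "'m::int_poly_module \<Rightarrow> 'm exterior" is "\<lambda>m. word [m]" .

text \<open>The $k$-th exterior power is the graded piece of degree $k$.\<close>

definition ext_power :: "nat \<Rightarrow> 'm::int_poly_module exterior set" where
  "ext_power k = module.span pscale {prod_list (map \<iota> ms) |ms. length ms = k}"


section \<open>The modules $M[D_n]$\<close>

text \<open>$M$ is the submodule $x\mathbb{Z}[x]$ of \<open>int poly\<close>, the basis vector $\epsilon^i$ being $x^i$, so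
  that $D_j$ is multiplication by $x^j$. The phantom parameter \<open>'n\<close> carries the integer
  \<open>n = CARD('n) \<ge> 1\<close>: the type \<open>'n shift_module\<close> is $M[D_n]$, where the variable of \<open>int poly\<close>
  acts as $D_n$, that is, $p$ acts as multiplication by $p(x^n)$.\<close>

typedef 'n shift_module = "{p :: int poly. coeff p 0 = 0}"
  by (rule exI[of _ 0]) simp

setup_lifting type_definition_shift_module

instantiation shift_module :: (finite) int_poly_module
begin

lift_definition zero_shift_module :: "'a shift_module" is 0 by simp
lift_definition plus_shift_module :: "'a shift_module \<Rightarrow> 'a shift_module \<Rightarrow> 'a shift_module"
  is "(+)" by simp
lift_definition uminus_shift_module :: "'a shift_module \<Rightarrow> 'a shift_module" is uminus by simp
lift_definition minus_shift_module :: "'a shift_module \<Rightarrow> 'a shift_module \<Rightarrow> 'a shift_module"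
  is "(-)" by simp
lift_definition pscale_shift_module :: "int poly \<Rightarrow> 'a shift_module \<Rightarrow> 'a shift_module"
  is "\<lambda>r p. pcompose r (monom 1 CARD('a)) * p" by (simp add: coeff_mult)

instance
proof
  fix r s :: "int poly" and x y z :: "'a shift_module"
  show "x + y + z = x + (y + z)" "x + y = y + x" "0 + x = x" "- x + x = 0" "x - y = x + - y"
    "r \<odot> (x + y) = r \<odot> x + r \<odot> y" "(r + s) \<odot> x = r \<odot> x + s \<odot> x"
    "r \<odot> (s \<odot> x) = (r * s) \<odot> x" "1 \<odot> x = x"
    by (transfer; simp add: algebra_simps pcompose_add pcompose_mult pcompose_1)+
qed

end

text \<open>Only the values \<open>\<epsilon> i\<close> with \<open>i \<ge> 1\<close> are meaningful.\<close>

lift_definition \<epsilon> :: "nat \<Rightarrow> 'n::finite shift_module" is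
  "\<lambda>i. if i = 0 then 0 else monom 1 i" by simp

lift_definition shift :: "nat \<Rightarrow> 'n::finite shift_module \<Rightarrow> 'n shift_module" is
  "\<lambda>j p. monom 1 j * p" by (simp add: coeff_mult)

lemma shift_add: "shift j (x + y) = shift j x + shift j y"
  by transfer (simp add: algebra_simps)

lemma shift_eps: "i \<ge> 1 \<Longrightarrow> shift j (\<epsilon> i) = \<epsilon> (i + j)"
  by transfer (simp add: mult_monom add.commute)

lemma shift_pscale: "shift j (r \<odot> x) = r \<odot> shift j x"
  by transfer (simp add: ac_simps)

lemma variable_pscale: "[:0, 1:] \<odot> x = shift CARD('n) (x :: 'n::finite shift_module)"
  by transfer (simp add: pcompose_pCons)


section \<open>The extension of $D_t$ to the exterior algebra\<close>

definition extends_shifts ::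
  "('n::finite shift_module exterior \<Rightarrow> 'n shift_module exterior fps) \<Rightarrow> bool" where
  "extends_shifts F \<longleftrightarrow>
     F 1 = 1 \<and>
     (\<forall>\<alpha> \<beta>. F (\<alpha> + \<beta>) = F \<alpha> + F \<beta>) \<and>
     (\<forall>\<alpha> \<beta>. F (\<alpha> * \<beta>) = F \<alpha> * F \<beta>) \<and>
     (\<forall>r \<alpha>. F (r \<odot> \<alpha>) = Abs_fps (\<lambda>j. r \<odot> fps_nth (F \<alpha>) j)) \<and>
     (\<forall>m. F (\<iota> m) = Abs_fps (\<lambda>j. \<iota> (shift j m)))"

text \<open>There is exactly one such map: evaluate words of the free algebra in the power series
  $D_t m$, which square to $0$ because the elements of $M$ anticommute in the exterior algebra.\<close>

lemma poly_mapping_sum_single: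
  "(x :: 'a \<Rightarrow>\<^sub>0 'b::comm_monoid_add) =
     (\<Sum>w\<in>Poly_Mapping.keys x. Poly_Mapping.single w (Poly_Mapping.lookup x w))"
  by (rule poly_mapping_eqI)
    (auto simp: lookup_sum lookup_single when_def sum.delta in_keys_iff)

lemma free_algebra_induct:
  fixes P :: "('a \<Rightarrow>\<^sub>0 'b::comm_monoid_add) \<Rightarrow> bool"
  assumes "P 0" "\<And>x y. P x \<Longrightarrow> P y \<Longrightarrow> P (x + y)" "\<And>w r. P (Poly_Mapping.single w r)"
  shows "P x"
proof -
  have "P (\<Sum>w\<in>S. Poly_Mapping.single w (Poly_Mapping.lookup x w))" if "finite S" for S
    using that by induction (auto intro: assms)
  then show ?thesis using poly_mapping_sum_single[of x] by (metis finite_keys)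
qed

lemma abs_word: "abs_exterior (word w) = prod_list (map \<iota> w)"
proof (induction w)
  case Nil then show ?case by (simp add: one_exterior.abs_eq zero_list_def flip: single_one)
next
  case (Cons a w)
  have "word (a # w) = word [a] * word w" by (simp add: mult_single plus_list_def)
  then show ?case using Cons by (simp add: \<iota>.abs_eq flip: times_exterior.abs_eq)
qed

lemma exterior_induct [case_names zero add prod]:
  assumes "P 0" "\<And>x y. P x \<Longrightarrow> P y \<Longrightarrow> P (x + y)" "\<And>r ms. P (r \<odot> prod_list (map \<iota> ms))"
  shows "P x"
proof (induction x rule: exterior.abs_induct)
  case (1 y)
  show ?case
  proof (induction y rule: free_algebra_induct)
    case 1 then show ?case using assms(1) by (simp add: zero_exterior.abs_eq)
  next
    case (2 x y) then show ?case using assms(2) by (simp flip: plus_exterior.abs_eq)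
  next
    case (3 w r)
    have "Poly_Mapping.single w r = const r * word w" by (simp add: mult_single plus_list_def)
    then have "abs_exterior (Poly_Mapping.single w r) = r \<odot> prod_list (map \<iota> w)"
      by (simp add: abs_word flip: pscale_exterior.abs_eq)
    then show ?case using assms(3) by simp
  qed
qed

lemma \<iota>_add: "\<iota> (m + m') = \<iota> m + \<iota> m'" by transfer (rule ext_cong.add)
lemma \<iota>_scale: "\<iota> (r \<odot> m) = r \<odot> \<iota> m" by transfer (rule ext_cong.scale)
lemma \<iota>_square: "\<iota> m * \<iota> m = 0" by transfer (rule ext_cong.square)
lemma \<iota>_anticommute: "\<iota> m * \<iota> m' = - (\<iota> m' * \<iota> m)"
proof -
  have "\<iota> m * \<iota> m' + \<iota> m' * \<iota> m = \<iota> (m + m') * \<iota> (m + m')"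
    by (simp only: \<iota>_add distrib_left distrib_right \<iota>_square add_0_left add_0_right add.commute)
  then show ?thesis by (simp only: \<iota>_square eq_neg_iff_add_eq_0)
qed

lemma const_comm: "const r * x = x * const r"
  by (induction x rule: free_algebra_induct)
    (simp_all add: distrib_left distrib_right mult_single plus_list_def mult.commute)

lemma pscale_mult_left: "(r \<odot> x) * y = r \<odot> (x * y :: 'm::int_poly_module exterior)"
  by transfer (simp add: mult.assoc ext_cong.refl)
lemma pscale_mult_right: "x * (r \<odot> y) = r \<odot> (x * y :: 'm::int_poly_module exterior)"
proof transfer
  fix r and x y :: "'m list \<Rightarrow>\<^sub>0 int poly"
  have "x * (const r * y) = const r * (x * y)"
    by (simp only: mult.assoc[symmetric] const_comm[of r x])
  then show "ext_cong (x * (const r * y)) (const r * (x * y))" by (simp only: ext_cong.refl)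
qed

interpretation pm: module "pscale :: int poly \<Rightarrow> 'a::int_poly_module \<Rightarrow> 'a" by (rule module_pscale)

definition fps_pscale :: "int poly \<Rightarrow> 'm::int_poly_module exterior fps \<Rightarrow> 'm exterior fps" where
  "fps_pscale r f = Abs_fps (\<lambda>j. r \<odot> fps_nth f j)"

lemma fps_pscale_simps:
  "fps_pscale r (f + g) = fps_pscale r f + fps_pscale r g"
  "fps_pscale (r + s) f = fps_pscale r f + fps_pscale s f"
  "fps_pscale r (fps_pscale s f) = fps_pscale (r * s) f"
  "fps_pscale 1 f = f" "fps_pscale 0 f = 0" "fps_pscale r 0 = 0"
  "fps_pscale r f * g = fps_pscale r (f * g)"
  "g * fps_pscale r f = fps_pscale r (g * f)"
  by (rule fps_ext; simp only: fps_pscale_def fps_mult_nth pscale_add_right pscale_add_left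
    pscale_pscale pscale_mult_left pscale_mult_right pm.scale_sum_right fps_nth_Abs_fps
    fps_add_nth fps_zero_nth pscale_one pm.scale_zero_left pm.scale_zero_right)+

definition shift_series :: "'n::finite shift_module \<Rightarrow> 'n shift_module exterior fps" where
  "shift_series m = Abs_fps (\<lambda>j. \<iota> (shift j m))"

lemma shift_series_square: "shift_series m * shift_series m = 0"
proof (rule fps_ext)
  fix j
  let ?c = "\<lambda>i. \<iota> (shift i m)"
  have *: "(\<Sum>(a, b)\<in>S. ?c a * ?c b) = 0" 
    if "finite S" "prod.swap ` S = S" for S
    using that
  proof (induction "card S" arbitrary: S rule: less_induct)
    case less
    show ?case
    proof (cases "S = {}")
      case False
      then obtain a b where ab: "(a, b) \<in> S" by auto
      then have ba: "(b, a) \<in> S" using less.prems(2) by (metis image_eqI swap_simp)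
      define S' where "S' = S - {(a,b),(b,a)}"
      have S: "S = {(a,b),(b,a)} \<union> S'" "{(a,b),(b,a)} \<inter> S' = {}" using ab ba by (auto simp: S'_def)
      have "card S' < card S" using ab less.prems by (auto simp: S'_def intro!: psubset_card_mono)
      moreover have "prod.swap ` S' = S'" 
        unfolding S'_def using less.prems by (auto simp: image_set_diff)
      ultimately have "(\<Sum>(a, b)\<in>S'. ?c a * ?c b) = 0" using less by (auto simp: S'_def)
      moreover have "(\<Sum>(a, b)\<in>{(a,b),(b,a)}. ?c a * ?c b) = 0"
        using \<iota>_anticommute[of "shift a m" "shift b m"] by (cases "a = b") (auto simp: \<iota>_square)
      ultimately show ?thesis using S less.prems(1)
        by (metis (no_types, lifting) add_0 sum.union_disjoint finite_Un)
    qed auto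
  qed
  have "fps_nth (shift_series m * shift_series m) j = (\<Sum>i=0..j. ?c i * ?c (j - i))" by (simp add: shift_series_def fps_mult_nth)
  also have "\<dots> = (\<Sum>(a, b)\<in>(\<lambda>i. (i, j - i)) ` {0..j}. ?c a * ?c b)"
    by (subst sum.reindex) (auto simp: inj_on_def)
  also have "\<dots> = 0"
    by (rule *) (auto simp: image_iff intro!: bexI[of _ "j - _"])
  finally show "fps_nth (shift_series m * shift_series m) j = fps_nth 0 j" by simp
qed

definition free_eval :: "('n::finite shift_module list \<Rightarrow>\<^sub>0 int poly) \<Rightarrow> 'n shift_module exterior fps" where
  "free_eval x = (\<Sum>w\<in>Poly_Mapping.keys x. fps_pscale (Poly_Mapping.lookup x w) (prod_list (map shift_series w)))"

lemma free_eval_super: "finite S \<Longrightarrow> Poly_Mapping.keys x \<subseteq> S \<Longrightarrow>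
   free_eval x = (\<Sum>w\<in>S. fps_pscale (Poly_Mapping.lookup x w) (prod_list (map shift_series w)))"
  unfolding free_eval_def by (rule sum.mono_neutral_left) (auto simp: in_keys_iff fps_pscale_simps)

lemma free_eval_add: "free_eval (x + y) = free_eval x + free_eval y"
  using free_eval_super[of "Poly_Mapping.keys x \<union> Poly_Mapping.keys y" "x+y"]
   free_eval_super[of "Poly_Mapping.keys x \<union> Poly_Mapping.keys y" x]
   free_eval_super[of "Poly_Mapping.keys x \<union> Poly_Mapping.keys y" y] keys_add[of x y]
  by (simp add: lookup_add fps_pscale_simps sum.distrib)

lemma free_eval_single: "free_eval (Poly_Mapping.single w r) = fps_pscale r (prod_list (map shift_series w))"
  using free_eval_super[of "{w}" "Poly_Mapping.single w r"] by simp

lemma free_eval_0: "free_eval 0 = 0" by (simp add: free_eval_def)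

lemma free_eval_mult: "free_eval (x * y) = free_eval x * free_eval y"
proof (induction x rule: free_algebra_induct)
  case (3 w r)
  show ?case 
    by (induction y rule: free_algebra_induct)
     (simp_all add: free_eval_0 distrib_left free_eval_add free_eval_single mult_single fps_pscale_simps plus_list_def mult.commute)
qed (simp_all add: free_eval_0 distrib_right free_eval_add)

lemma free_eval_const: "free_eval (const r) = fps_pscale r 1" by (simp add: free_eval_single)

lemma free_eval_cong: "ext_cong x y \<Longrightarrow> free_eval x = free_eval y"
proof (induction rule: ext_cong.induct)
  case (add m m')
  show ?case by (simp add: free_eval_add free_eval_single fps_pscale_simps shift_series_def shift_add \<iota>_add fps_eq_iff)
next
  case (scale r m)
  show ?case by (simp add: free_eval_add free_eval_mult free_eval_single fps_pscale_simps shift_series_def shift_pscale \<iota>_scale fps_eq_iff)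
     (simp add: fps_pscale_def)
qed (simp_all add: free_eval_add free_eval_mult free_eval_single free_eval_0 fps_pscale_simps shift_series_square)

lift_definition ext_hom :: "'n::finite shift_module exterior \<Rightarrow> 'n shift_module exterior fps" is free_eval
  by (rule free_eval_cong)

lemma extends_shifts_ext_hom: "extends_shifts ext_hom"
  unfolding extends_shifts_def
proof (intro conjI allI)
  show "ext_hom 1 = (1 :: 'a shift_module exterior fps)"
    by transfer (simp add: free_eval_single fps_pscale_simps zero_list_def flip: single_one)
  fix a b :: "'a shift_module exterior" and r and m :: "'a shift_module"
  show "ext_hom (a + b) = ext_hom a + ext_hom b" by transfer (rule free_eval_add)
  show "ext_hom (a * b) = ext_hom a * ext_hom b" by transfer (rule free_eval_mult)
  show "ext_hom (r \<odot> a) = Abs_fps (\<lambda>j. r \<odot> fps_nth (ext_hom a) j)"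
    unfolding fps_pscale_def[symmetric] by transfer (simp add: free_eval_mult free_eval_const fps_pscale_simps)
  show "ext_hom (\<iota> m) = Abs_fps (\<lambda>j. \<iota> (shift j m))"
    unfolding shift_series_def[symmetric] by transfer (simp add: free_eval_single fps_pscale_simps)
qed

lemma ex1_extends_shifts: "\<exists>!F. extends_shifts (F :: 'n::finite shift_module exterior \<Rightarrow> _)"
proof (rule ex_ex1I)
  show "\<exists>F. extends_shifts (F :: 'n shift_module exterior \<Rightarrow> _)" using extends_shifts_ext_hom by blast
  fix F G :: "'n shift_module exterior \<Rightarrow> 'n shift_module exterior fps"
  assume F: "extends_shifts F" and G: "extends_shifts G"
  have 0: "F 0 = 0" "G 0 = 0" using F G unfolding extends_shifts_def
    by (metis add.right_neutral add_left_cancel)+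
  have P: "F (prod_list (map \<iota> ms)) = G (prod_list (map \<iota> ms))" for ms
    by (induction ms) (use F G in \<open>auto simp: extends_shifts_def\<close>)
  show "F = G"
  proof
    fix x show "F x = G x"
      by (induction x rule: exterior_induct) (use F G 0 P in \<open>auto simp: extends_shifts_def\<close>)
  qed
qed

definition D_t :: "'n::finite shift_module exterior \<Rightarrow> 'n shift_module exterior fps" where
  "D_t = (THE F. extends_shifts F)"

lemma extends_shifts_D_t: "extends_shifts D_t"
  unfolding D_t_def by (rule theI'[OF ex1_extends_shifts])

definition D_ext :: "nat \<Rightarrow> 'n::finite shift_module exterior \<Rightarrow> 'n shift_module exterior" where
  "D_ext j \<alpha> = fps_nth (D_t \<alpha>) j"

end

theory Submission
  imports Defs "HOL-Combinatorics.Permutations"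
begin

text \<open>The exterior power is free with basis the wedges of increasing sequences of the basis vectors
  \<open>\<epsilon> 1, \<dots>, \<epsilon> n\<close>. That they span is a matter of reordering factors up to sign
  (\<open>ext_power_span_wedge\<close>). For their independence, every alternating multilinear form on lists of
  vectors induces a linear form on the exterior algebra (\<open>alternating_form_extends\<close>), and the minors
  of the coordinate matrix form a family dual to the wedges (\<open>wedge_independent\<close>).

  The base ring is Noetherian by Hilbert's basis theorem (\<open>hilbert_basis\<close>). The $D_j$ commute because
  the shifts of single vectors do.

  The main point is that the polynomials in the $D_j$ applied to $\epsilon^1\wedge\cdots\wedge\epsilon^k$
  exhaust the exterior power. Since $D_t\epsilon^i = \epsilon^i + t D_t\epsilon^{i+1}$ and
  $D_t\epsilon^{i+1}\wedge D_t\epsilon^{i+1} = 0$, one gets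
  \[ D_t(\epsilon^1\wedge\cdots\wedge\epsilon^{j+1}) =
     \epsilon^1\wedge\cdots\wedge\epsilon^j\wedge D_t\epsilon^{j+1}. \]
  Hence $D_a(\epsilon^1\wedge\cdots\wedge\epsilon^{j+1}\wedge\beta)$ is
  $\epsilon^1\wedge\cdots\wedge\epsilon^j\wedge\epsilon^{j+1+a}\wedge\beta$ plus the terms
  $\epsilon^1\wedge\cdots\wedge\epsilon^j\wedge\epsilon^{j+1+i}\wedge D_{a-i}\beta$ with $i < a$. So if all
  elements starting with $\epsilon^1\wedge\cdots\wedge\epsilon^{j+1}$ are generated, induction on $a$ shows the
  same for all elements starting with $\epsilon^1\wedge\cdots\wedge\epsilon^j$. Descending from $j = k$ to
  $j = 0$ yields the whole exterior power (\<open>initial_wedge_generates\<close>).\<close>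

section \<open>Noetherian rings\<close>

interpretation ring_module: module "(*) :: 'a::comm_ring_1 \<Rightarrow> 'a \<Rightarrow> 'a"
  by unfold_locales (simp_all add: algebra_simps)

(* For multiplication this is associativity oriented to the left, which loops with mult.assoc. *)
declare ring_module.scale_scale [simp del]

lemma noetherian_int: "noetherian TYPE(int)"
  unfolding noetherian_def
proof (intro allI impI)
  fix I :: "int set"
  assume I: "ring_module.subspace I"
  have "\<exists>d\<in>I. \<forall>y\<in>I. d dvd y"
  proof (cases "I \<subseteq> {0}")
    case True
    then show ?thesis using ring_module.subspace_0[OF I] by auto
  next
    case False
    then obtain x where x: "x \<in> I" "x \<noteq> 0" by auto
    then have "-x \<in> I" using ring_module.subspace_neg[OF I] by simp
    then have ex: "\<exists>m::nat. m > 0 \<and> int m \<in> I"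
      using x by (intro exI[of _ "nat \<bar>x\<bar>"]) (auto simp: abs_if)
    define m where "m = (LEAST m::nat. m > 0 \<and> int m \<in> I)"
    have m: "m > 0" "int m \<in> I" using LeastI_ex[OF ex] by (auto simp: m_def)
    have min: "m \<le> m'" if "m' > 0" "int m' \<in> I" for m'
      unfolding m_def using that by (intro Least_le) auto
    have "int m dvd y" if y: "y \<in> I" for y
    proof -
      have "y mod int m = y - (y div int m) * int m" by (simp add: minus_div_mult_eq_mod)
      also have "\<dots> \<in> I" 
        by (rule ring_module.subspace_diff[OF I y]) (rule ring_module.subspace_scale[OF I m(2)])
      finally have *: "y mod int m \<in> I" .
      have "0 \<le> y mod int m" "y mod int m < int m" using m by auto
      moreover from this have "0 < nat (y mod int m) \<longrightarrow> m \<le> nat (y mod int m)"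
        using min[of "nat (y mod int m)"] * by simp
      ultimately have "y mod int m = 0" by linarith
      then show ?thesis by (rule mod_0_imp_dvd)
    qed
    then show ?thesis using m by blast
  qed
  then obtain d where d: "d \<in> I" "\<forall>y\<in>I. d dvd y" by blast
  have "y \<in> ring_module.span {d}" if y: "y \<in> I" for y
  proof -
    obtain c where "y = d * c" using d y by (auto elim: dvdE)
    then show ?thesis using ring_module.span_scale[OF ring_module.span_base, of d "{d}" c]
      by (simp add: mult.commute)
  qed
  moreover have "ring_module.span {d} \<subseteq> I"
    using ring_module.span_minimal[of "{d}" I] I d by auto
  ultimately have "I = ring_module.span {d}" by auto
  then show "\<exists>F. finite F \<and> I = ring_module.span F" by (intro exI[of _ "{d}"]) simp
qed

text \<open>An ascending chain condition in disguise: the ideal generated by all terms of a sequence is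
  generated by finitely many elements, and these already lie in the ideal generated by finitely
  many terms.\<close>

lemma noetherian_term_in_span_of_predecessors:
  fixes a :: "nat \<Rightarrow> 'a::comm_ring_1"
  assumes "noetherian TYPE('a)"
  obtains N where "a N \<in> ring_module.span (a ` {..<N})"
proof -
  have *: "\<exists>N. c \<in> ring_module.span (a ` {..<N})" if "c \<in> ring_module.span (range a)" for c
    using that
  proof (induction rule: ring_module.span_induct_alt)
    case base
    then show ?case using ring_module.span_zero by blast
  next
    case (step u x y)
    then obtain N i where N: "y \<in> ring_module.span (a ` {..<N})" and i: "x = a i" by auto
    have "a i \<in> ring_module.span (a ` {..<max N (Suc i)})"
      by (intro ring_module.span_base imageI) auto
    moreover have "y \<in> ring_module.span (a ` {..<max N (Suc i)})"
      using N ring_module.span_mono[of "a ` {..<N}" "a ` {..<max N (Suc i)}"]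
      by (meson image_mono in_mono lessThan_subset_iff max.cobounded1)
    ultimately show ?case unfolding i
      using ring_module.span_add[OF ring_module.span_scale] by blast
  qed
  obtain F where F: "finite F" "ring_module.span (range a) = ring_module.span F"
    using assms ring_module.subspace_span unfolding noetherian_def by metis
  have "\<forall>x\<in>F. \<exists>N. x \<in> ring_module.span (a ` {..<N})"
    using * F ring_module.span_superset by fast
  then obtain h where h: "\<And>x. x \<in> F \<Longrightarrow> x \<in> ring_module.span (a ` {..<h x})" by metis
  define N where "N = Max (insert 0 (h ` F))"
  have "F \<subseteq> ring_module.span (a ` {..<N})"
  proof
    fix x assume x: "x \<in> F"
    then have "h x \<le> N" unfolding N_def using F by (intro Max_ge) auto
    then show "x \<in> ring_module.span (a ` {..<N})"
      using h[OF x] ring_module.span_mono[of "a ` {..<h x}" "a ` {..<N}"]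
      by (meson image_mono in_mono lessThan_subset_iff)
  qed
  then have "ring_module.span (range a) \<subseteq> ring_module.span (a ` {..<N})"
    unfolding F by (intro ring_module.span_minimal) auto
  then have "a N \<in> ring_module.span (a ` {..<N})" using ring_module.span_base[of "a N" "range a"] by auto
  then show ?thesis by (rule that)
qed

text \<open>In an ideal that is not finitely generated one can choose \<open>f 0, f 1, \<dots>\<close> such that \<open>f n\<close> has
  least degree among the elements of the ideal outside the span of its predecessors. Some leading
  coefficient is a combination of the earlier ones; multiplying the corresponding \<open>f i\<close> by powers
  of the variable and subtracting lowers the degree of that \<open>f N\<close>, or kills it, without entering the span of
  its predecessors, against minimality.\<close>

lemma hilbert_basis:
  assumes "noetherian TYPE('a::comm_ring_1)"
  shows "noetherian TYPE('a poly)"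
  unfolding noetherian_def
proof (intro allI impI, rule ccontr)
  fix I :: "'a poly set"
  assume I: "ring_module.subspace I" and nfg: "\<nexists>F. finite F \<and> I = ring_module.span F"
  let ?S = "\<lambda>f n. ring_module.span (f ` {..<n::nat}) :: 'a poly set"
  let ?P = "\<lambda>f n p. p \<in> I - ?S f n \<and> (\<forall>q\<in>I - ?S f n. degree p \<le> degree q)"
  have "\<exists>f. \<forall>n. ?P f n (f n)"
  proof (rule dependent_wellorder_choice)
    fix r :: "'a poly" and f g :: "nat \<Rightarrow> 'a poly" and n :: nat
    assume "\<And>y. y < n \<Longrightarrow> f y = g y"
    then have "f ` {..<n} = g ` {..<n}" by (auto intro!: image_cong)
    then show "?P f n r = ?P g n r" by simp
  next
    fix n :: nat and f :: "nat \<Rightarrow> 'a poly"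
    assume "\<And>y. y < n \<Longrightarrow> ?P f y (f y)"
    then have "f ` {..<n} \<subseteq> I" by auto
    then have "?S f n \<subseteq> I" using I by (intro ring_module.span_minimal)
    moreover have "?S f n \<noteq> I" using nfg by blast
    ultimately obtain p where "p \<in> I - ?S f n" by blast
    from ex_has_least_nat[of "\<lambda>p. p \<in> I - ?S f n", OF this, of degree]
    show "\<exists>p. ?P f n p" by blast
  qed
  then obtain f where f: "\<And>n. f n \<in> I" "\<And>n. f n \<notin> ?S f n"
    and min: "\<And>n q. q \<in> I \<Longrightarrow> q \<notin> ?S f n \<Longrightarrow> degree (f n) \<le> degree q" by auto
  have mono: "degree (f i) \<le> degree (f n)" if "i < n" for i n
  proof -
    have "?S f i \<subseteq> ?S f n" using that by (intro ring_module.span_mono) auto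
    then show ?thesis using f min by blast
  qed
  obtain N where N: "lead_coeff (f N) \<in> ring_module.span ((\<lambda>i. lead_coeff (f i)) ` {..<N})"
    by (rule noetherian_term_in_span_of_predecessors[OF assms, where a = "\<lambda>i. lead_coeff (f i)"])
  let ?d = "degree (f N)"
  \<comment> \<open>The degrees do not decrease along the sequence, so every \<open>f i\<close> with \<open>i < N\<close> can be shifted up to degree \<open>?d\<close>.\<close>
  have "\<exists>g\<in>?S f N. degree g \<le> ?d \<and> coeff g ?d = c"
    if "c \<in> ring_module.span ((\<lambda>i. lead_coeff (f i)) ` {..<N})" for c
    using that
  proof (induction rule: ring_module.span_induct_alt)
    case base
    then show ?case using ring_module.span_zero by (intro bexI[of _ 0]) auto
  next
    case (step u x y)
    then obtain i g where i: "i < N" "x = lead_coeff (f i)"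
      and g: "g \<in> ?S f N" "degree g \<le> ?d" "coeff g ?d = y" by auto
    let ?g = "monom u (?d - degree (f i)) * f i + g"
    have "degree (f i) \<le> ?d" using mono i by simp
    then have "degree (monom u (?d - degree (f i)) * f i) \<le> ?d"
      using degree_mult_le[of "monom u (?d - degree (f i))" "f i"] degree_monom_le[of u "?d - degree (f i)"]
      by simp
    then have "degree ?g \<le> ?d" using g by (intro degree_add_le)
    moreover have "coeff ?g ?d = u * x + y"
      using i g \<open>degree (f i) \<le> ?d\<close> by (simp add: coeff_monom_mult)
    moreover have "?g \<in> ?S f N"
      by (intro ring_module.span_add ring_module.span_scale ring_module.span_base g(1) imageI) (use i in simp)
    ultimately show ?case by blast
  qed
  from this[OF N] obtain g where g: "g \<in> ?S f N" "degree g \<le> ?d" "coeff g ?d = lead_coeff (f N)"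
    by blast
  have "?S f N \<subseteq> I" using I f by (intro ring_module.span_minimal) auto
  then have "f N - g \<in> I" using I f g by (intro ring_module.subspace_diff) auto
  moreover have notin: "f N - g \<notin> ?S f N"
    using f(2)[of N] ring_module.span_add[OF _ g(1), of "f N - g"] by auto
  ultimately have "?d \<le> degree (f N - g)" by (rule min)
  moreover have "degree (f N - g) \<le> ?d" using g by (intro degree_diff_le) auto
  moreover have "coeff (f N - g) ?d = 0" using g by simp
  ultimately have "f N - g = 0" by (metis leading_coeff_0_iff le_antisym)
  then show False using notin ring_module.span_zero by metis
qed

section \<open>Alternating forms on the exterior algebra\<close>

definition word_sum :: "('m list \<Rightarrow> int poly) \<Rightarrow> ('m list \<Rightarrow>\<^sub>0 int poly) \<Rightarrow> int poly" where
  "word_sum f x = (\<Sum>w\<in>Poly_Mapping.keys x. Poly_Mapping.lookup x w * f w)"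

lemma word_sum_super:
  "finite S \<Longrightarrow> Poly_Mapping.keys x \<subseteq> S \<Longrightarrow> word_sum f x = (\<Sum>w\<in>S. Poly_Mapping.lookup x w * f w)"
  unfolding word_sum_def by (rule sum.mono_neutral_left) (auto simp: in_keys_iff)

lemma word_sum_add: "word_sum f (x + y) = word_sum f x + word_sum f y"
  using word_sum_super[of "Poly_Mapping.keys x \<union> Poly_Mapping.keys y" "x+y" f]
   word_sum_super[of "Poly_Mapping.keys x \<union> Poly_Mapping.keys y" x f]
   word_sum_super[of "Poly_Mapping.keys x \<union> Poly_Mapping.keys y" y f] keys_add[of x y]
  by (simp add: lookup_add algebra_simps sum.distrib)

lemma word_sum_single: "word_sum f (Poly_Mapping.single w r) = r * f w"
  using word_sum_super[of "{w}" "Poly_Mapping.single w r" f] by simp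

lemma word_sum_zero: "word_sum f 0 = 0" by (simp add: word_sum_def)

lemma word_sum_const_mult: "word_sum f (const r * x) = r * word_sum f x"
  by (induction x rule: free_algebra_induct)
   (simp_all add: word_sum_zero word_sum_add word_sum_single distrib_left mult_single plus_list_def)

definition alternating_form :: "('m::int_poly_module list \<Rightarrow> int poly) \<Rightarrow> bool" where
  "alternating_form f \<longleftrightarrow>
     (\<forall>u v m m'. f (u @ (m + m') # v) = f (u @ m # v) + f (u @ m' # v)) \<and>
     (\<forall>u v r m. f (u @ (r \<odot> m) # v) = r * f (u @ m # v)) \<and>
     (\<forall>u v m. f (u @ m # m # v) = 0)"

lemma word_sum_sandwich:
  assumes "\<And>u v r s. word_sum f (Poly_Mapping.single u r * x * Poly_Mapping.single v s) =
    word_sum f (Poly_Mapping.single u r * y * Poly_Mapping.single v s)"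
  shows "word_sum f (a * x * b) = word_sum f (a * y * b)"
proof (induction a rule: free_algebra_induct)
  case (3 u r)
  show ?case
    by (induction b rule: free_algebra_induct)
       (simp_all add: assms word_sum_zero word_sum_add distrib_left)
qed (simp_all add: word_sum_zero word_sum_add distrib_right)

text \<open>The congruence is closed under products, so an induction on its derivation cannot prove
  \<open>word_sum f x = word_sum f y\<close> directly. The version with arbitrary factors on both sides is
  itself closed under products.\<close>

lemma alternating_form_cong:
  assumes f: "alternating_form f" and "ext_cong x y"
  shows "word_sum f (a * x * b) = word_sum f (a * y * b)"
  using assms(2)
proof (induction arbitrary: a b rule: ext_cong.induct)
  case (add m m')
  show ?case 
    by (rule word_sum_sandwich) (use f[unfolded alternating_form_def] in
      \<open>simp add: word_sum_add word_sum_single mult_single plus_list_def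
        distrib_left distrib_right\<close>)
next
  case (scale r m)
  show ?case 
    by (rule word_sum_sandwich) (use f[unfolded alternating_form_def] in
      \<open>simp add: word_sum_single mult_single plus_list_def\<close>)
next
  case (square m)
  show ?case 
    by (rule word_sum_sandwich) (use f[unfolded alternating_form_def] in
      \<open>simp add: word_sum_zero word_sum_single mult_single plus_list_def\<close>)
next
  case (plus x x' y y')
  then show ?case by (simp add: word_sum_add distrib_left distrib_right)
next
  case (times x x' y y')
  have "word_sum f (a * (x * y) * b) = word_sum f (a * x * (y * b))" by (simp add: mult.assoc)
  also have "\<dots> = word_sum f (a * x' * (y * b))" by (rule times.IH)
  also have "\<dots> = word_sum f ((a * x') * y * b)" by (simp add: mult.assoc)
  also have "\<dots> = word_sum f ((a * x') * y' * b)" by (rule times.IH)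
  finally show ?case by (simp add: mult.assoc)
qed simp_all

text \<open>The universal property of the exterior algebra, for forms with values in the base ring. It is
  what makes it possible to prove that elements of the exterior algebra are different, although
  its relations are given only by generators.\<close>

lemma alternating_form_extends:
  fixes f :: "'m::int_poly_module list \<Rightarrow> int poly"
  assumes "alternating_form f"
  obtains F :: "'m exterior \<Rightarrow> int poly" where
    "\<And>x y. F (x + y) = F x + F y" "\<And>r x. F (r \<odot> x) = r * F x"
    "\<And>ms. F (prod_list (map \<iota> ms)) = f ms"
proof -
  have rel: "ext_cong (rep_exterior (abs_exterior x)) x" for x :: "'m list \<Rightarrow>\<^sub>0 int poly"
    using Quotient3_exterior Quotient3_rep_abs ext_cong.refl by metis
  define F where "F = (\<lambda>x :: 'm exterior. word_sum f (rep_exterior x))"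
  have F: "F (abs_exterior x) = word_sum f x" for x
    using alternating_form_cong[OF assms rel[of x], of 1 1] by (simp add: F_def)
  show thesis
  proof (rule that[of F])
    show "F (x + y) = F x + F y" for x y
      by (induction x rule: exterior.abs_induct; induction y rule: exterior.abs_induct)
         (simp add: plus_exterior.abs_eq F word_sum_add)
    show "F (r \<odot> x) = r * F x" for r x
      by (induction x rule: exterior.abs_induct)
         (simp add: pscale_exterior.abs_eq F word_sum_const_mult)
    show "F (prod_list (map \<iota> ms)) = f ms" for ms
      by (simp add: F word_sum_single flip: abs_word)
  qed
qed

section \<open>Minors as alternating forms\<close>

text \<open>The minor of the matrix \<open>c j m\<close> with rows \<open>ms\<close> and columns \<open>js\<close>. Words of any other length than
  \<open>js\<close> are sent to \<open>0\<close>, since an alternating form has to be given on the whole free algebra.\<close>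

definition det_form :: "(nat \<Rightarrow> 'm \<Rightarrow> int poly) \<Rightarrow> nat list \<Rightarrow> 'm list \<Rightarrow> int poly" where
  "det_form c js ms =
     (if length ms = length js
      then \<Sum>p | p permutes {..<length js}. of_int (sign p) * (\<Prod>a<length js. c (js ! p a) (ms ! a))
      else 0)"

text \<open>The second factor mentions \<open>undefined\<close> in place of \<open>m\<close> to make visible that it does not depend
  on \<open>m\<close>, which is what multilinearity needs.\<close>

lemma prod_nth_split:
  fixes g :: "nat \<Rightarrow> 'm \<Rightarrow> 'r::comm_monoid_mult"
  shows "(\<Prod>a<Suc (length u + length v). g a ((u @ m # v) ! a)) =
    g (length u) m * (\<Prod>a\<in>{..<Suc (length u + length v)} - {length u}. g a ((u @ undefined # v) ! a))"
proof -
  have "(\<Prod>a<Suc (length u + length v). g a ((u @ m # v) ! a)) =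
    g (length u) m * (\<Prod>a\<in>{..<Suc (length u + length v)} - {length u}. g a ((u @ m # v) ! a))"
    by (subst prod.remove[of _ "length u"]) simp_all
  also have "(\<Prod>a\<in>{..<Suc (length u + length v)} - {length u}. g a ((u @ m # v) ! a)) =
      (\<Prod>a\<in>{..<Suc (length u + length v)} - {length u}. g a ((u @ undefined # v) ! a))"
    by (intro prod.cong refl arg_cong[of _ _ "g _"]) (auto simp: nth_append nth_Cons')
  finally show ?thesis .
qed

lemma alternating_det_form:
  fixes c :: "nat \<Rightarrow> 'm::int_poly_module \<Rightarrow> int poly"
  assumes add: "\<And>i x y. c i (x + y) = c i x + c i y"
    and scale: "\<And>i r x. c i (r \<odot> x) = r * c i x"
  shows "alternating_form (det_form c js)"
  unfolding alternating_form_def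
proof (intro conjI allI)
  fix u v :: "'m list" and m m' :: 'm and r :: "int poly"
  show "det_form c js (u @ (m + m') # v) = det_form c js (u @ m # v) + det_form c js (u @ m' # v)"
  proof (cases "length js = Suc (length u + length v)")
    case True
    then show ?thesis
      by (simp add: det_form_def prod_nth_split[of "\<lambda>a. c (js ! _ a)"] add distrib_right distrib_left sum.distrib
          del: prod.lessThan_Suc)
  qed (simp add: det_form_def)
  show "det_form c js (u @ (r \<odot> m) # v) = r * det_form c js (u @ m # v)"
  proof (cases "length js = Suc (length u + length v)")
    case True
    then show ?thesis
      by (simp add: det_form_def prod_nth_split[of "\<lambda>a. c (js ! _ a)"] scale sum_distrib_left mult_ac
          del: prod.lessThan_Suc)
  qed (simp add: det_form_def)
  show "det_form c js (u @ m # m # v) = 0"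
  proof (cases "length js = length (u @ m # m # v)")
    case True
    let ?w = "u @ m # m # v" and ?i = "length u" and ?n = "length js"
    let ?q = "Transposition.transpose ?i (Suc ?i)"
    let ?g = "\<lambda>p. of_int (sign p) * (\<Prod>a<?n. c (js ! p a) (?w ! a)) :: int poly"
    have q: "?q permutes {..<?n}" using True by (intro permutes_swap_id) auto
    have w: "?w ! ?q a = ?w ! a" for a
      by (cases "a = ?i"; cases "a = Suc ?i") (auto simp: nth_append Transposition.transpose_def)
    have "?g (p \<circ> ?q) = - ?g p" if p: "p permutes {..<?n}" for p
    proof -
      have "sign (p \<circ> ?q) = - sign p"
        using p q by (subst sign_compose) (auto simp: sign_swap_id intro: permutes_imp_permutation)
      moreover have "(\<Prod>a<?n. c (js ! (p \<circ> ?q) a) (?w ! a)) = (\<Prod>a<?n. c (js ! p a) (?w ! a))"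
        by (rule prod.reindex_bij_witness[of _ ?q ?q])
           (use permutes_in_image[OF q] w in auto)
      ultimately show ?thesis by simp
    qed
    \<comment> \<open>Swapping the two equal rows pairs off the summands with opposite signs.\<close>
    then have "(\<Sum>p | p permutes {..<?n}. ?g p) = - (\<Sum>p | p permutes {..<?n}. ?g p)"
      by (subst sum_permutations_compose_right[OF q]) (simp add: sum_negf)
    then show ?thesis using True by (simp add: det_form_def)
  qed (simp add: det_form_def)
qed

lemma det_form_delta_same:
  assumes c: "\<And>i j. i \<in> set js \<Longrightarrow> j \<in> set js \<Longrightarrow> c j (e i) = (if i = j then 1 else 0)"
    and js: "distinct js"
  shows "det_form c js (map e js) = 1"
proof -
  let ?n = "length js"
  have entry: "c (js ! p a) (e (js ! a)) = (if p a = a then 1 else 0)"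
    if "p permutes {..<?n}" "a < ?n" for p a
    using that permutes_in_image[OF that(1), of a] js by (subst c) (auto simp: nth_eq_iff_index_eq)
  have "of_int (sign p) * (\<Prod>a<?n. c (js ! p a) (map e js ! a)) = (if p = id then 1 else 0)"
    if p: "p permutes {..<?n}" for p
  proof (cases "p = id")
    case True
    then show ?thesis using entry[OF p] by simp
  next
    case False
    then obtain a where "p a \<noteq> a" by (auto simp: fun_eq_iff)
    then have "a < ?n" using p by (meson lessThan_iff permutes_not_in)
    then have "(\<Prod>a<?n. c (js ! p a) (map e js ! a)) = 0"
      using entry[OF p] \<open>p a \<noteq> a\<close> by (intro prod_zero bexI[of _ a]) auto
    then show ?thesis using False by simp
  qed
  then have "det_form c js (map e js) = (\<Sum>p | p permutes {..<?n}. if p = id then 1 else 0)"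
    by (simp add: det_form_def)
  also have "\<dots> = 1" by (simp add: permutes_id sum.delta finite_permutations)
  finally show ?thesis .
qed

lemma det_form_zero_row:
  assumes "m \<in> set ms" "\<And>j. j \<in> set js \<Longrightarrow> c j m = 0"
  shows "det_form c js ms = 0"
proof (cases "length ms = length js")
  case True
  obtain a where a: "a < length ms" "ms ! a = m" using assms(1) by (auto simp: in_set_conv_nth)
  have "(\<Prod>a<length js. c (js ! p a) (ms ! a)) = 0" if "p permutes {..<length js}" for p
    using that a assms(2) permutes_in_image[OF that(1), of a] True
    by (intro prod_zero bexI[of _ a]) auto
  then show ?thesis unfolding det_form_def by (auto intro!: sum.neutral simp del: prod_zero_iff)
qed (simp add: det_form_def)

section \<open>Bases of exterior powers\<close>

lemma mult_in_span_products:
  fixes x y :: "'m::int_poly_module exterior"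
  assumes "x \<in> pm.span A" "y \<in> pm.span B"
  shows "x * y \<in> pm.span {a * b |a b. a \<in> A \<and> b \<in> B}"
  using assms(1)
proof (induction rule: pm.span_induct_alt)
  case base
  then show ?case by (simp add: pm.span_zero)
next
  case (step r a x')
  have "a * y \<in> pm.span {a * b |a b. a \<in> A \<and> b \<in> B}"
    using assms(2)
  proof (induction rule: pm.span_induct_alt)
    case base
    then show ?case by (simp add: pm.span_zero)
  next
    case (step s b y')
    have "a * b \<in> pm.span {a * b |a b. a \<in> A \<and> b \<in> B}"
      using \<open>a \<in> A\<close> step by (intro pm.span_base) blast
    then show ?case unfolding distrib_left pscale_mult_right
      by (intro pm.span_add pm.span_scale step)
  qed
  then show ?case unfolding distrib_right pscale_mult_left
    by (intro pm.span_add pm.span_scale step)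
qed

lemma \<iota>_in_span:
  fixes E :: "'m::int_poly_module set"
  assumes "m \<in> pm.span E"
  shows "\<iota> m \<in> pm.span (\<iota> ` E)"
  using assms
proof (induction rule: pm.span_induct_alt)
  case base
  have "\<iota> (0 :: 'm) = 0" using \<iota>_scale[of 0 "0 :: 'm"] by simp
  then show ?case by (simp add: pm.span_zero)
next
  case (step r x y)
  have "\<iota> x \<in> pm.span (\<iota> ` E)" using step by (intro pm.span_base imageI)
  then show ?case unfolding \<iota>_add \<iota>_scale using step by (intro pm.span_add pm.span_scale)
qed

lemma prod_in_ext_power: "length ms = k \<Longrightarrow> prod_list (map \<iota> ms) \<in> ext_power k"
  unfolding ext_power_def by (intro pm.span_base) blast

lemma ext_power_0: "ext_power 0 = pm.span {1}"
  by (simp add: ext_power_def)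

text \<open>Both the basis and the generation statement below are proved by splitting off the first factor
  of a product; here it may be restricted to any set of generators of the module.\<close>

lemma ext_power_Suc:
  fixes E :: "'m::int_poly_module set"
  assumes E: "pm.span E = UNIV" and B: "pm.span B = ext_power k"
  shows "ext_power (Suc k) = pm.span {\<iota> e * b |e b. e \<in> E \<and> b \<in> B}"
proof
  have "prod_list (map \<iota> ms) \<in> pm.span {\<iota> e * b |e b. e \<in> E \<and> b \<in> B}"
    if ms: "length ms = Suc k" for ms :: "'m list"
  proof -
    obtain m ms' where "ms = m # ms'" "length ms' = k" using ms by (cases ms) auto
    then have "prod_list (map \<iota> ms) \<in> pm.span {a * b |a b. a \<in> \<iota> ` E \<and> b \<in> B}"
      using mult_in_span_products[of "\<iota> m" "\<iota> ` E" "prod_list (map \<iota> ms')" B]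
        \<iota>_in_span[of m E] E B prod_in_ext_power[of ms' k] by simp
    also have "{a * b |a b. a \<in> \<iota> ` E \<and> b \<in> B} = {\<iota> e * b |e b. e \<in> E \<and> b \<in> B}" by blast
    finally show ?thesis .
  qed
  then show "ext_power (Suc k) \<subseteq> pm.span {\<iota> e * b |e b. e \<in> E \<and> b \<in> B}"
    unfolding ext_power_def[of "Suc k"] by (intro pm.span_minimal) auto
next
  have "\<iota> e * b \<in> ext_power (Suc k)" if "b \<in> B" for e :: 'm and b
  proof -
    have "b \<in> pm.span {prod_list (map \<iota> ms) |ms. length ms = k}"
      using that B pm.span_base[of b B] by (simp add: ext_power_def)
    then have "\<iota> e * b \<in> pm.span {x * y |x y. x \<in> {\<iota> e} \<and> y \<in> {prod_list (map \<iota> ms) |ms. length ms = k}}"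
      by (intro mult_in_span_products) (auto intro: pm.span_base)
    also have "\<dots> \<subseteq> ext_power (Suc k)"
      unfolding ext_power_def
    proof (intro pm.span_mono subsetI)
      fix z assume "z \<in> {x * y |x y. x \<in> {\<iota> e} \<and> y \<in> {prod_list (map \<iota> ms) |ms. length ms = k}}"
      then obtain ms where "z = prod_list (map \<iota> (e # ms))" "length (e # ms) = Suc k" by auto
      then show "z \<in> {prod_list (map \<iota> ms) |ms. length ms = Suc k}" by blast
    qed
    finally show ?thesis .
  qed
  then show "pm.span {\<iota> e * b |e b. e \<in> E \<and> b \<in> B} \<subseteq> ext_power (Suc k)"
    unfolding ext_power_def by (intro pm.span_minimal) auto
qed

definition wedge :: "(nat \<Rightarrow> 'm::int_poly_module) \<Rightarrow> nat set \<Rightarrow> 'm exterior" where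
  "wedge e I = prod_list (map (\<lambda>i. \<iota> (e i)) (sorted_list_of_set I))"

lemma \<iota>_mult_repeated:
  "a \<in> set xs \<Longrightarrow> \<iota> (e a) * prod_list (map (\<lambda>i. \<iota> (e i)) xs) = 0"
proof (induction xs)
  case (Cons x xs)
  let ?P = "prod_list (map (\<lambda>i. \<iota> (e i)) xs)"
  show ?case
  proof (cases "a = x")
    case True
    then show ?thesis by (simp add: mult.assoc[symmetric] \<iota>_square)
  next
    case False
    have "\<iota> (e a) * (\<iota> (e x) * ?P) = - (\<iota> (e x) * (\<iota> (e a) * ?P))"
      by (simp add: mult.assoc[symmetric] \<iota>_anticommute[of "e a" "e x"])
    then show ?thesis using Cons False by simp
  qed
qed simp

lemma \<iota>_mult_insort:
  "\<iota> (e a) * prod_list (map (\<lambda>i. \<iota> (e i)) xs) = prod_list (map (\<lambda>i. \<iota> (e i)) (insort a xs)) \<or>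
   \<iota> (e a) * prod_list (map (\<lambda>i. \<iota> (e i)) xs) = - prod_list (map (\<lambda>i. \<iota> (e i)) (insort a xs))"
proof (induction xs)
  case (Cons x xs)
  let ?P = "prod_list (map (\<lambda>i. \<iota> (e i)) xs)"
  have "\<iota> (e a) * (\<iota> (e x) * ?P) = - (\<iota> (e x) * (\<iota> (e a) * ?P))"
    by (simp add: mult.assoc[symmetric] \<iota>_anticommute[of "e a" "e x"])
  then show ?case using Cons by auto
qed simp

lemma ext_power_span_wedge:
  fixes e :: "nat \<Rightarrow> 'm::int_poly_module"
  assumes e: "pm.span (e ` {1..n}) = UNIV"
  shows "pm.span {wedge e I |I. I \<subseteq> {1..n} \<and> card I = k} = ext_power k"
proof (induction k)
  case 0
  have "I \<subseteq> {1..n} \<and> card I = 0 \<longleftrightarrow> I = {}" for I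
    using finite_subset[of I "{1..n}"] by auto
  then have "{wedge e I |I. I \<subseteq> {1..n} \<and> card I = 0} = {1}" by (simp add: wedge_def)
  then show ?case by (simp add: ext_power_0)
next
  case (Suc k)
  let ?W = "\<lambda>k. {wedge e I |I. I \<subseteq> {1..n} \<and> card I = k}"
  note * = ext_power_Suc[OF e Suc.IH]
  have "\<iota> (e i) * wedge e I \<in> pm.span (?W (Suc k))"
    if "i \<in> {1..n}" "I \<subseteq> {1..n}" "card I = k" for i I
  proof -
    have fin: "finite I" using that finite_subset by blast
    show ?thesis
    proof (cases "i \<in> I")
      case True
      then show ?thesis using \<iota>_mult_repeated[of i "sorted_list_of_set I" e] fin
        by (simp add: wedge_def pm.span_zero)
    next
      case False
      have "wedge e (insert i I) \<in> pm.span (?W (Suc k))"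
        using that fin False by (intro pm.span_base CollectI exI[of _ "insert i I"]) auto
      then show ?thesis
        using \<iota>_mult_insort[of e i "sorted_list_of_set I"] fin False pm.span_neg
        by (auto simp: wedge_def)
    qed
  qed
  then have "ext_power (Suc k) \<subseteq> pm.span (?W (Suc k))"
    unfolding * by (intro pm.span_minimal) auto
  moreover have "wedge e I \<in> ext_power (Suc k)" if "card I = Suc k" for I
    using that prod_in_ext_power[of "map e (sorted_list_of_set I)" "Suc k"]
    by (simp add: wedge_def comp_def)
  then have "pm.span (?W (Suc k)) \<subseteq> ext_power (Suc k)"
    unfolding ext_power_def by (intro pm.span_minimal) auto
  ultimately show ?case by blast
qed

text \<open>The minors with columns \<open>J\<close> are a dual family to the wedges: on \<open>wedge e I\<close> with
  \<open>I \<noteq> J\<close> of the same size, an index of \<open>I\<close> outside \<open>J\<close> gives a zero row.\<close>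

lemma wedge_independent:
  fixes e :: "nat \<Rightarrow> 'm::int_poly_module"
  assumes c: "\<And>i x y. c i (x + y) = c i x + c i y" "\<And>i r x. c i (r \<odot> x) = r * c i x"
    and dual: "\<And>i j. i \<in> {1..n} \<Longrightarrow> j \<in> {1..n} \<Longrightarrow> c j (e i) = (if i = j then 1 else 0)"
  shows "pm.independent {wedge e I |I. I \<subseteq> {1..n} \<and> card I = k}"
  unfolding pm.independent_explicit_module
proof (intro allI impI)
  fix t u v
  assume t: "finite t" "t \<subseteq> {wedge e I |I. I \<subseteq> {1..n} \<and> card I = k}" "v \<in> t"
    and zero: "(\<Sum>v\<in>t. u v \<odot> v) = 0"
  from t obtain J where J: "v = wedge e J" "J \<subseteq> {1..n}" "card J = k" by blast
  then have fin: "finite J" using finite_subset by blast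
  obtain F where F: "\<And>x y. F (x + y) = F x + F y" "\<And>r x. F (r \<odot> x) = r * F x"
    and F_prod: "\<And>ms. F (prod_list (map \<iota> ms)) = det_form c (sorted_list_of_set J) ms"
    using alternating_form_extends[OF alternating_det_form[of c, OF c]] by metis
  have F0: "F 0 = 0" using F(2)[of 0 0] by simp
  have Fsum: "F (\<Sum>v\<in>t. u v \<odot> v) = (\<Sum>v\<in>t. u v * F v)"
    using t(1) by induction (auto simp: F F0)
  have F_wedge: "F (wedge e I) = det_form c (sorted_list_of_set J) (map e (sorted_list_of_set I))" for I
    using F_prod[of "map e (sorted_list_of_set I)"] by (simp add: wedge_def comp_def)
  have "F v = 1"
    unfolding J F_wedge using J fin by (intro det_form_delta_same) (auto simp: dual subset_iff)
  moreover have "F w = 0" if w: "w \<in> t" "w \<noteq> v" for w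
  proof -
    obtain I where I: "w = wedge e I" "I \<subseteq> {1..n}" "card I = k" using w t by blast
    then have "finite I" using finite_subset by blast
    moreover have "\<not> I \<subseteq> J" using I J w fin card_subset_eq[of J I] by auto
    ultimately obtain i where i: "i \<in> I" "i \<notin> J" "finite I" by blast
    have "c j (e i) = 0" if "j \<in> J" for j
      using dual[of i j] that i I J by (auto simp: subset_iff)
    then show ?thesis unfolding I F_wedge using i fin
      by (intro det_form_zero_row[of "e i"]) auto
  qed
  ultimately have "(\<Sum>w\<in>t. u w * F w) = u v"
    using t by (subst sum.remove[of _ v]) auto
  then show "u v = 0" using Fsum zero F0 by simp
qed

section \<open>The basis of $M[D_n]$\<close>

text \<open>The coefficient of \<open>\<epsilon> i\<close> in the basis \<open>\<epsilon> 1, \<dots>, \<epsilon> n\<close> over the polynomials in the shift by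
  \<open>n = CARD('n)\<close> collects the exponents congruent to \<open>i\<close> modulo \<open>n\<close>. For larger \<open>i\<close> this
  formula would not be linear over \<open>int poly\<close>; the value \<open>0\<close> outside \<open>{1..n}\<close> makes
  all coordinates linear.\<close>

definition coord :: "nat \<Rightarrow> 'n::finite shift_module \<Rightarrow> int poly" where
  "coord i m = (if i \<in> {1..CARD('n)}
     then Abs_poly (\<lambda>j. coeff (Rep_shift_module m) (i + CARD('n) * j)) else 0)"

lemma coeff_coord:
  fixes m :: "'n::finite shift_module"
  shows "coeff (coord i m) j =
    (if i \<in> {1..CARD('n)} then coeff (Rep_shift_module m) (i + CARD('n) * j) else 0)"
proof (cases "i \<in> {1..CARD('n)}")
  case True
  have "coeff (Rep_shift_module m) (i + CARD('n) * j) = 0" if "j > degree (Rep_shift_module m)" for j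
  proof -
    have "j \<le> CARD('n) * j" by simp
    then show ?thesis using that by (intro coeff_eq_0) linarith
  qed
  then show ?thesis using True
    by (simp add: coord_def coeff_Abs_poly[of "degree (Rep_shift_module m)"])
qed (unfold coord_def if_not_P, simp)

lemma coord_add: "coord i (x + y) = coord i x + coord i y"
  by (rule poly_eqI) (simp add: coeff_coord plus_shift_module.rep_eq)

text \<open>It suffices to treat constants and the variable. For the variable, the coefficient of \<open>\<epsilon> 0\<close>,
  which would enter for \<open>i = n\<close>, vanishes in \<open>M\<close>.\<close>

lemma coord_pscale:
  fixes m :: "'n::finite shift_module"
  shows "coord i (r \<odot> m) = r * coord i m"
proof (induction r arbitrary: m)
  case 0
  have "coord i (0 :: 'n shift_module) = 0"
    by (rule poly_eqI) (simp add: coeff_coord zero_shift_module.rep_eq)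
  then show ?case by simp
next
  case (pCons a r)
  have const: "coord i ([:a:] \<odot> m) = smult a (coord i m)"
    by (rule poly_eqI) (simp add: coeff_coord pscale_shift_module.rep_eq)
  have var: "coord i ([:0, 1:] \<odot> m) = [:0, 1:] * coord i m" for m :: "'n shift_module"
  proof (rule poly_eqI)
    fix j
    have 0: "coeff (Rep_shift_module m) 0 = 0" using Rep_shift_module[of m] by simp
    show "coeff (coord i ([:0, 1:] \<odot> m)) j = coeff ([:0, 1:] * coord i m) j"
      using 0 by (cases j) (auto simp: coeff_coord pscale_shift_module.rep_eq pcompose_pCons
          coeff_monom_mult coeff_pCons le_less)
  qed
  have "pCons a r \<odot> m = ([:a:] + [:0, 1:] * r) \<odot> m" by simp
  also have "coord i \<dots> = coord i ([:a:] \<odot> m) + coord i ([:0, 1:] \<odot> (r \<odot> m))"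
    by (simp only: pscale_add_left coord_add pscale_pscale)
  also have "\<dots> = pCons a r * coord i m" unfolding const var pCons.IH by simp
  finally show ?case .
qed

lemma coord_eps:
  assumes "i \<in> {1..CARD('n)}" "j \<in> {1..CARD('n)}"
  shows "coord j (\<epsilon> i :: 'n::finite shift_module) = (if i = j then 1 else 0)"
proof (rule poly_eqI)
  fix k
  have "i = j + CARD('n) * k \<longleftrightarrow> i = j \<and> k = 0" using assms by (cases k) auto
  then show "coeff (coord j (\<epsilon> i :: 'n shift_module)) k = coeff (if i = j then 1 else 0) k"
    using assms by (auto simp: coeff_coord \<epsilon>.rep_eq)
qed

lemma Rep_shift_module_sum: "Rep_shift_module (sum f A) = (\<Sum>a\<in>A. Rep_shift_module (f a))"
  by (induction A rule: infinite_finite_induct)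
     (simp_all add: zero_shift_module.rep_eq plus_shift_module.rep_eq)

lemma span_eps_all: "pm.span (\<epsilon> ` {1..}) = (UNIV :: 'n::finite shift_module set)"
proof -
  have "m \<in> pm.span (\<epsilon> ` {1..})" for m :: "'n shift_module"
  proof -
    let ?p = "Rep_shift_module m"
    have "m = (\<Sum>i\<in>{1..degree ?p}. [:coeff ?p i:] \<odot> \<epsilon> i)"
    proof (rule Rep_shift_module_inject[THEN iffD1], rule poly_eqI)
      fix j
      have 0: "coeff ?p 0 = 0" using Rep_shift_module[of m] by simp
      have "coeff (Rep_shift_module (\<Sum>i\<in>{1..degree ?p}. [:coeff ?p i:] \<odot> \<epsilon> i)) j =
          (\<Sum>i\<in>{1..degree ?p}. if i = j then coeff ?p i else 0)"
        unfolding Rep_shift_module_sum coeff_sum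
        by (intro sum.cong) (auto simp: pscale_shift_module.rep_eq \<epsilon>.rep_eq)
      also have "\<dots> = coeff ?p j"
        using 0 by (cases "j = 0") (auto simp: sum.delta' coeff_eq_0)
      finally show "coeff ?p j = coeff (Rep_shift_module (\<Sum>i\<in>{1..degree ?p}. [:coeff ?p i:] \<odot> \<epsilon> i)) j" ..
    qed
    also have "\<dots> \<in> pm.span (\<epsilon> ` {1..})"
      by (intro pm.span_sum pm.span_scale pm.span_base imageI) simp
    finally show ?thesis .
  qed
  then show ?thesis by blast
qed

text \<open>Every \<open>\<epsilon> i\<close> with \<open>i > n\<close> is the variable times \<open>\<epsilon> (i - n)\<close>.\<close>

lemma span_eps_basis: "pm.span (\<epsilon> ` {1..CARD('n)}) = (UNIV :: 'n::finite shift_module set)"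
proof -
  have "(\<epsilon> i :: 'n shift_module) \<in> pm.span (\<epsilon> ` {1..CARD('n)})" if "i \<ge> 1" for i
    using that
  proof (induction i rule: less_induct)
    case (less i)
    show ?case
    proof (cases "i \<le> CARD('n)")
      case True
      then show ?thesis using less.prems by (intro pm.span_base imageI) simp
    next
      case False
      then have "(\<epsilon> i :: 'n shift_module) = [:0, 1:] \<odot> \<epsilon> (i - CARD('n))"
        by (simp add: variable_pscale shift_eps)
      also have "\<dots> \<in> pm.span (\<epsilon> ` {1..CARD('n)})"
        using False by (intro pm.span_scale less.IH) auto
      finally show ?thesis .
    qed
  qed
  then have "pm.span (\<epsilon> ` {1..}) \<subseteq> pm.span (\<epsilon> ` {1..CARD('n)} :: 'n shift_module set)"
    by (intro pm.span_minimal) auto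
  then show ?thesis unfolding span_eps_all by blast
qed

lemma free_ext_power: "free_submodule pscale (ext_power k :: 'n::finite shift_module exterior set)"
  unfolding free_submodule_def
proof (intro exI conjI)
  let ?B = "{wedge \<epsilon> I |I. I \<subseteq> {1..CARD('n)} \<and> card I = k} :: 'n shift_module exterior set"
  show "pm.independent ?B"
    by (rule wedge_independent[of coord, OF coord_add coord_pscale coord_eps])
  show "pm.span ?B = ext_power k"
    by (rule ext_power_span_wedge[OF span_eps_basis])
qed

section \<open>Polynomials in commuting endomorphisms\<close>

definition span_monomials ::
  "('a::comm_ring_1 \<Rightarrow> 'b::ab_group_add \<Rightarrow> 'b) \<Rightarrow> (nat \<Rightarrow> 'b \<Rightarrow> 'b) \<Rightarrow> 'b \<Rightarrow> 'b set" where
  "span_monomials scale D x = module.span scale (range (\<lambda>\<mu>. monomial_op D \<mu> x))"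

lemma range_poly_op:
  assumes "module scale"
  shows "range (\<lambda>P. poly_op scale D P x) = span_monomials scale D x"
proof -
  interpret module scale by fact
  have super: "poly_op scale D P x = (\<Sum>\<mu>\<in>A. scale (Poly_Mapping.lookup P \<mu>) (monomial_op D \<mu> x))"
    if "finite A" "Poly_Mapping.keys P \<subseteq> A" for A P
    unfolding poly_op_def using that by (intro sum.mono_neutral_left) (auto simp: in_keys_iff)
  have single: "poly_op scale D (Poly_Mapping.single \<mu> c) x = scale c (monomial_op D \<mu> x)" for \<mu> c
    using super[of "{\<mu>}" "Poly_Mapping.single \<mu> c"] by simp
  have add: "poly_op scale D (P + Q) x = poly_op scale D P x + poly_op scale D Q x" for P Q
    using super[of "Poly_Mapping.keys P \<union> Poly_Mapping.keys Q" P]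
      super[of "Poly_Mapping.keys P \<union> Poly_Mapping.keys Q" Q]
      super[of "Poly_Mapping.keys P \<union> Poly_Mapping.keys Q" "P + Q"] keys_add[of P Q]
    by (simp add: lookup_add scale_left_distrib sum.distrib)
  have "y \<in> range (\<lambda>P. poly_op scale D P x)" if "y \<in> span (range (\<lambda>\<mu>. monomial_op D \<mu> x))" for y
    using that
  proof (induction rule: span_induct_alt)
    case base
    then show ?case by (intro image_eqI[of _ _ 0]) (simp_all add: poly_op_def)
  next
    case (step c y z)
    then obtain \<mu> P where "y = monomial_op D \<mu> x" "z = poly_op scale D P x" by blast
    then show ?case by (intro image_eqI[of _ _ "Poly_Mapping.single \<mu> c + P"]) (simp_all add: add single)
  qed
  moreover have "poly_op scale D P x \<in> span (range (\<lambda>\<mu>. monomial_op D \<mu> x))" for P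
    unfolding poly_op_def by (intro span_sum span_scale span_base rangeI)
  ultimately show ?thesis unfolding span_monomials_def by blast
qed

text \<open>The evaluation of a monomial along an arbitrary list of variables. It allows variables of
  exponent \<open>0\<close>, so that a monomial can be compared with its product by a new variable.\<close>

primrec apply_powers :: "(nat \<Rightarrow> 'b \<Rightarrow> 'b) \<Rightarrow> (nat \<Rightarrow> nat) \<Rightarrow> nat list \<Rightarrow> 'b \<Rightarrow> 'b" where
  "apply_powers D c [] x = x"
| "apply_powers D c (i # xs) x = (D (Suc i) ^^ c i) (apply_powers D c xs x)"

lemma monomial_op_apply_powers:
  assumes "finite A" "Poly_Mapping.keys \<mu> \<subseteq> A"
  shows "monomial_op D \<mu> x = apply_powers D (Poly_Mapping.lookup \<mu>) (sorted_list_of_set A) x"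
proof -
  let ?keys = "\<lambda>xs. filter (\<lambda>i. i \<in> Poly_Mapping.keys \<mu>) xs"
  have keys: "?keys (sorted_list_of_set A) = sorted_list_of_set (Poly_Mapping.keys \<mu>)"
    using assms by (intro sorted_distinct_set_unique) (auto simp: sorted_wrt_filter)
  have "foldr (\<lambda>i f. (D (Suc i) ^^ Poly_Mapping.lookup \<mu> i) \<circ> f) (?keys xs) id x =
      apply_powers D (Poly_Mapping.lookup \<mu>) xs x" for xs
    by (induction xs) (auto simp: in_keys_iff)
  then show ?thesis unfolding monomial_op_def keys[symmetric] .
qed

lemma apply_powers_cong: "(\<And>i. i \<in> set xs \<Longrightarrow> c i = c' i) \<Longrightarrow> apply_powers D c xs x = apply_powers D c' xs x"
  by (induction xs) auto

text \<open>For commuting endomorphisms, multiplying a monomial by a variable composes its value with the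
  endomorphism of that variable. This makes the span of the monomials stable under all \<open>D j\<close>.\<close>

context
  fixes D :: "nat \<Rightarrow> 'b \<Rightarrow> 'b" and N :: "'b set"
  assumes comm: "\<And>i j x. x \<in> N \<Longrightarrow> D i (D j x) = D j (D i x)"
    and closed: "\<And>i x. x \<in> N \<Longrightarrow> D i x \<in> N"
begin

lemma funpow_closed: "x \<in> N \<Longrightarrow> (D i ^^ n) x \<in> N"
  by (induction n) (auto intro: closed)

lemma funpow_commute: "x \<in> N \<Longrightarrow> (D i ^^ n) (D j x) = D j ((D i ^^ n) x)"
  by (induction n) (auto simp: comm funpow_closed)

lemma apply_powers_closed: "x \<in> N \<Longrightarrow> apply_powers D c xs x \<in> N"
  by (induction xs) (auto intro: funpow_closed)

lemma monomial_op_closed: "x \<in> N \<Longrightarrow> monomial_op D \<mu> x \<in> N"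
  using monomial_op_apply_powers[of "Poly_Mapping.keys \<mu>" \<mu> D x] by (simp add: apply_powers_closed)

lemma apply_powers_increment:
  assumes "x \<in> N" "distinct xs" "j \<in> set xs"
  shows "apply_powers D (c(j := Suc (c j))) xs x = D (Suc j) (apply_powers D c xs x)"
  using assms(2,3)
proof (induction xs)
  case (Cons i xs)
  show ?case
  proof (cases "i = j")
    case True
    then have "apply_powers D (c(j := Suc (c j))) xs x = apply_powers D c xs x"
      using Cons.prems by (intro apply_powers_cong) auto
    then show ?thesis using True by (simp del: fun_upd_apply add: fun_upd_same)
  next
    case False
    then show ?thesis using Cons apply_powers_closed[OF assms(1)]
      by (simp del: fun_upd_apply add: fun_upd_other funpow_commute)
  qed
qed simp

lemma monomial_op_increment:
  assumes "x \<in> N"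
  shows "monomial_op D (\<mu> + Poly_Mapping.single j 1) x = D (Suc j) (monomial_op D \<mu> x)"
proof -
  let ?A = "insert j (Poly_Mapping.keys \<mu>)" and ?c = "Poly_Mapping.lookup \<mu>"
  have "Poly_Mapping.keys (\<mu> + Poly_Mapping.single j 1) \<subseteq> ?A"
    using keys_add[of \<mu> "Poly_Mapping.single j 1"] by auto
  then have "monomial_op D (\<mu> + Poly_Mapping.single j 1) x =
      apply_powers D (Poly_Mapping.lookup (\<mu> + Poly_Mapping.single j 1)) (sorted_list_of_set ?A) x"
    by (intro monomial_op_apply_powers) auto
  also have "Poly_Mapping.lookup (\<mu> + Poly_Mapping.single j 1) = ?c(j := Suc (?c j))"
    by (auto simp: lookup_add lookup_single when_def)
  also have "apply_powers D \<dots> (sorted_list_of_set ?A) x =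
      D (Suc j) (apply_powers D ?c (sorted_list_of_set ?A) x)"
    by (rule apply_powers_increment[OF assms]) (simp_all only: set_sorted_list_of_set finite_insert finite_keys distinct_sorted_list_of_set insertI1)
  also have "\<dots> = D (Suc j) (monomial_op D \<mu> x)"
    by (subst monomial_op_apply_powers[of ?A \<mu>]) auto
  finally show ?thesis .
qed

end

section \<open>The coefficients of $D_t$\<close>

lemma D_t_simps:
  fixes x y :: "'n::finite shift_module exterior"
  shows "D_t (1 :: 'n shift_module exterior) = 1"
    "D_t (x + y) = D_t x + D_t y"
    "D_t (x * y) = D_t x * D_t y"
    "D_t (r \<odot> x) = fps_pscale r (D_t x)"
    "D_t (\<iota> m) = shift_series (m :: 'n shift_module)"
  using extends_shifts_D_t[where ?'a = 'n]
  unfolding extends_shifts_def shift_series_def fps_pscale_def by blast+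

lemma D_ext_simps:
  fixes x y :: "'n::finite shift_module exterior"
  shows "D_ext j (1 :: 'n shift_module exterior) = (if j = 0 then 1 else 0)"
    "D_ext j (x + y) = D_ext j x + D_ext j y"
    "D_ext j (r \<odot> x) = r \<odot> D_ext j x"
    "D_ext j (\<iota> m) = \<iota> (shift j (m :: 'n shift_module))"
  unfolding D_ext_def D_t_simps by (simp_all add: fps_pscale_def shift_series_def)

lemma D_ext_mult: "D_ext j (x * y) = (\<Sum>i=0..j. D_ext i x * D_ext (j - i) y)"
  unfolding D_ext_def D_t_simps by (rule fps_mult_nth)

lemma D_ext_zero: "D_ext j 0 = 0"
  using D_ext_simps(3)[of j 0 0] by simp

lemma D_ext_sum: "D_ext j (sum f A) = (\<Sum>a\<in>A. D_ext j (f a))"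
  by (induction A rule: infinite_finite_induct) (simp_all add: D_ext_zero D_ext_simps)

lemma shift_0: "shift 0 m = m"
  by transfer simp

lemma shift_shift: "shift i (shift j m) = shift j (shift i m)"
  by transfer (simp add: ac_simps)

lemma D_ext_0: "D_ext 0 x = x"
proof (induction x rule: exterior_induct)
  case (prod r ms)
  have "D_ext 0 (prod_list (map \<iota> ms)) = prod_list (map \<iota> ms)"
    by (induction ms) (simp_all add: D_ext_simps D_ext_mult shift_0)
  then show ?case by (simp add: D_ext_simps)
qed (simp_all add: D_ext_zero D_ext_simps)

text \<open>On a product, the product rule turns both sides into the same double sum with the order of
  summation exchanged, so commutativity is inherited from the shifts of single factors.\<close>

lemma D_ext_commute: "D_ext i (D_ext j x) = D_ext j (D_ext i x)"
proof (induction x arbitrary: i j rule: exterior_induct)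
  case (prod r ms)
  have "D_ext i (D_ext j (prod_list (map \<iota> ms))) = D_ext j (D_ext i (prod_list (map \<iota> ms)))" for i j
  proof (induction ms arbitrary: i j)
    case (Cons m ms)
    let ?x = "\<iota> m" and ?y = "prod_list (map \<iota> ms)"
    have D: "D_ext i (D_ext j (?x * ?y)) =
      (\<Sum>a=0..j. \<Sum>b=0..i. D_ext b (D_ext a ?x) * D_ext (i - b) (D_ext (j - a) ?y))" for i j
      by (simp add: D_ext_mult D_ext_sum)
    have "D_ext i (D_ext j (?x * ?y)) = D_ext j (D_ext i (?x * ?y))"
      unfolding D by (subst sum.swap) (simp add: D_ext_simps shift_shift Cons)
    then show ?case by simp
  qed (simp add: D_ext_simps D_ext_zero)
  then show ?case by (simp add: D_ext_simps)
qed (simp_all add: D_ext_zero D_ext_simps)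

lemma \<iota>_mult_ext_power: "b \<in> ext_power k \<Longrightarrow> \<iota> m * b \<in> ext_power (Suc k)"
  using ext_power_Suc[of UNIV "ext_power k" k] pm.span_span unfolding ext_power_def[of k]
  by (auto intro!: pm.span_base)

lemma ext_power_subspace: "pm.subspace (ext_power k)"
  unfolding ext_power_def by (rule pm.subspace_span)

lemma D_ext_closed:
  assumes "x \<in> ext_power k"
  shows "D_ext j x \<in> ext_power k"
  using assms unfolding ext_power_def[of k]
proof (induction rule: pm.span_induct_alt)
  case base
  then show ?case by (simp add: D_ext_zero pm.span_zero)
next
  case (step r x y)
  have "D_ext j (prod_list (map \<iota> ms)) \<in> ext_power (length ms)" for ms
  proof (induction ms arbitrary: j)
    case Nil
    then show ?case by (simp add: ext_power_0 D_ext_simps pm.span_base pm.span_zero)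
  next
    case (Cons m ms)
    then show ?case
      by (auto simp: D_ext_mult D_ext_simps intro!: pm.subspace_sum[OF ext_power_subspace] \<iota>_mult_ext_power)
  qed
  then have "D_ext j x \<in> ext_power k" using step by auto
  then show ?case using step unfolding D_ext_simps ext_power_def
    by (intro pm.span_add pm.span_scale)
qed

lemma span_monomials_subset:
  assumes "x \<in> ext_power k"
  shows "span_monomials pscale D_ext x \<subseteq> ext_power k"
  unfolding span_monomials_def
  using monomial_op_closed[of "ext_power k" D_ext x, OF D_ext_commute D_ext_closed assms]
  by (intro pm.span_minimal ext_power_subspace) auto

lemma D_ext_span_monomials:
  assumes "y \<in> span_monomials pscale D_ext x"
  shows "D_ext j y \<in> span_monomials pscale D_ext x"
proof (cases j)
  case 0
  then show ?thesis using assms by (simp add: D_ext_0)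
next
  case (Suc i)
  show ?thesis using assms unfolding span_monomials_def
  proof (induction rule: pm.span_induct_alt)
    case base
    then show ?case by (simp add: D_ext_zero pm.span_zero)
  next
    case (step r y z)
    then obtain \<mu> where "y = monomial_op D_ext \<mu> x" by auto
    then have "D_ext j y = monomial_op D_ext (\<mu> + Poly_Mapping.single i 1) x"
      using monomial_op_increment[of UNIV D_ext x \<mu> i, OF D_ext_commute] Suc by simp
    then show ?case unfolding D_ext_simps
      by (intro pm.span_add pm.span_scale pm.span_base step) auto
  qed
qed

section \<open>Generation by the initial wedge\<close>

definition initial_wedge :: "nat \<Rightarrow> 'n::finite shift_module exterior" where
  "initial_wedge k = prod_list (map (\<lambda>i. \<iota> (\<epsilon> i)) [1..<k + 1])"

lemma initial_wedge_simps:
  "initial_wedge 0 = 1" "initial_wedge (Suc k) = initial_wedge k * \<iota> (\<epsilon> (Suc k))"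
  by (simp_all add: initial_wedge_def)

lemma initial_wedge_mult_eps:
  assumes "i \<in> {1..j}"
  shows "initial_wedge j * \<iota> (\<epsilon> i) = (0 :: 'n::finite shift_module exterior)"
  using assms
proof (induction j)
  case (Suc j)
  let ?w = "initial_wedge j :: 'n shift_module exterior"
  show ?case
  proof (cases "i = Suc j")
    case True
    then show ?thesis by (simp add: initial_wedge_simps mult.assoc \<iota>_square)
  next
    case False
    have "?w * \<iota> (\<epsilon> (Suc j)) * \<iota> (\<epsilon> i) = - (?w * \<iota> (\<epsilon> i) * \<iota> (\<epsilon> (Suc j)))"
      by (simp add: mult.assoc \<iota>_anticommute[of "\<epsilon> (Suc j)" "\<epsilon> i"])
    then show ?thesis using Suc False by (simp add: initial_wedge_simps)
  qed
qed simp

text \<open>The recursion $D_t \epsilon^i = \epsilon^i + t D_t \epsilon^{i+1}$.\<close>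

lemma shift_series_eps:
  assumes "i \<ge> 1"
  shows "shift_series (\<epsilon> i :: 'n::finite shift_module) =
    fps_const (\<iota> (\<epsilon> i)) + fps_X * shift_series (\<epsilon> (Suc i))"
proof (rule fps_ext)
  fix j
  show "fps_nth (shift_series (\<epsilon> i :: 'n shift_module)) j =
    fps_nth (fps_const (\<iota> (\<epsilon> i)) + fps_X * shift_series (\<epsilon> (Suc i))) j"
    using assms by (cases j) (simp_all add: shift_series_def shift_eps)
qed

text \<open>All factors but the last stay fixed: in the product of the series of two consecutive \<open>\<epsilon> i\<close>,
  the recursion for the first one leaves, besides \<open>\<iota> (\<epsilon> i)\<close>, only a multiple of the second
  one, and the latter has square \<open>0\<close>.\<close>

lemma D_t_initial_wedge:
  "D_t (initial_wedge (Suc j) :: 'n::finite shift_module exterior) =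
     fps_const (initial_wedge j) * shift_series (\<epsilon> (Suc j))"
proof (induction j)
  case 0
  then show ?case by (simp add: initial_wedge_simps D_t_simps)
next
  case (Suc j)
  let ?w = "initial_wedge j :: 'n shift_module exterior"
  let ?s = "shift_series (\<epsilon> (Suc (Suc j))) :: 'n shift_module exterior fps"
  have "D_t (initial_wedge (Suc (Suc j)) :: 'n shift_module exterior) =
      fps_const ?w * (fps_const (\<iota> (\<epsilon> (Suc j))) + fps_X * ?s) * ?s"
    by (simp only: initial_wedge_simps(2)[of "Suc j"] D_t_simps Suc shift_series_eps[of "Suc j"])
  also have "\<dots> = fps_const (?w * \<iota> (\<epsilon> (Suc j))) * ?s"
    by (simp add: distrib_left distrib_right mult.assoc shift_series_square fps_const_mult[symmetric] del: fps_const_mult)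
  finally show ?case by (simp only: initial_wedge_simps)
qed

lemma D_ext_initial_wedge:
  "D_ext a (initial_wedge (Suc j)) = initial_wedge j * \<iota> (\<epsilon> (Suc j + a))"
  unfolding D_ext_def D_t_initial_wedge by (simp add: shift_series_def shift_eps)

text \<open>The number \<open>d\<close> of free factors increases while the fixed initial part \<open>\<epsilon> 1, \<dots>, \<epsilon> j\<close> shrinks.
  A new free factor can be taken to be \<open>\<epsilon> (Suc j + a)\<close>, since smaller indices repeat a factor of
  the initial part. By the preceding lemma, this product with \<open>b\<close> is the last term in the product
  rule for \<open>D_ext a (initial_wedge (Suc j) * b)\<close>, and the other terms have smaller \<open>a\<close>.\<close>

lemma initial_wedge_generates:
  fixes k :: nat
  defines "S \<equiv> span_monomials pscale D_ext (initial_wedge k :: 'n::finite shift_module exterior)"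
  assumes "j + d = k" "b \<in> ext_power d"
  shows "initial_wedge j * b \<in> S"
proof -
  have sub: "pm.subspace S" by (simp add: S_def span_monomials_def)
  have lin: "initial_wedge j * b \<in> S" if "b \<in> pm.span B" "\<And>b. b \<in> B \<Longrightarrow> initial_wedge j * b \<in> S" for j b B
    using that(1)
  proof (induction rule: pm.span_induct_alt)
    case base
    then show ?case by (simp add: pm.subspace_0[OF sub])
  next
    case (step c x y)
    then have "initial_wedge j * x \<in> S" by (intro that(2))
    then show ?case unfolding distrib_left pscale_mult_right using step
      by (intro pm.subspace_add[OF sub] pm.subspace_scale[OF sub])
  qed
  show ?thesis using assms(2,3)
  proof (induction d arbitrary: j b)
    case 0
    have "monomial_op D_ext 0 (initial_wedge k) \<in> S"
      unfolding S_def span_monomials_def by (intro pm.span_base rangeI)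
    then have "initial_wedge k \<in> S" by (simp add: monomial_op_def)
    then show ?case using 0 by (intro lin[of b "{1}"]) (auto simp: ext_power_0)
  next
    case (Suc d)
    have step: "initial_wedge j * (\<iota> (\<epsilon> (Suc j + a)) * b) \<in> S" if "b \<in> ext_power d" for a b
      using that
    proof (induction a arbitrary: b rule: less_induct)
      case (less a)
      let ?t = "\<lambda>i. initial_wedge j * (\<iota> (\<epsilon> (Suc j + i)) * D_ext (a - i) b)"
      have "D_ext a (initial_wedge (Suc j) * b) = (\<Sum>i<Suc a. ?t i)"
        unfolding D_ext_mult D_ext_initial_wedge mult.assoc atLeast0AtMost lessThan_Suc_atMost ..
      also have "\<dots> = (\<Sum>i<a. ?t i) + ?t a" by (rule sum.lessThan_Suc)
      finally have eq: "?t a = D_ext a (initial_wedge (Suc j) * b) - (\<Sum>i<a. ?t i)" by simp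
      have "initial_wedge (Suc j) * b \<in> S" using Suc less.prems by simp
      then have "D_ext a (initial_wedge (Suc j) * b) \<in> S"
        unfolding S_def by (rule D_ext_span_monomials)
      moreover have "(\<Sum>i<a. ?t i) \<in> S"
        by (intro pm.subspace_sum[OF sub] less.IH D_ext_closed less.prems) simp
      ultimately have "?t a \<in> S" unfolding eq by (rule pm.subspace_diff[OF sub])
      then show ?case by (simp add: D_ext_0)
    qed
    have gens: "ext_power (Suc d) = pm.span {\<iota> e * b |e b. e \<in> \<epsilon> ` {1..} \<and> b \<in> (ext_power d :: 'n shift_module exterior set)}"
      by (intro ext_power_Suc span_eps_all) (simp add: ext_power_subspace)
    from Suc.prems(2)[unfolded gens] show ?case
    proof (rule lin)
      fix x assume "x \<in> {\<iota> e * b |e b. e \<in> \<epsilon> ` {1..} \<and> b \<in> (ext_power d :: 'n shift_module exterior set)}"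
      then obtain i b where x: "x = \<iota> (\<epsilon> i) * b" "i \<ge> 1" "b \<in> ext_power d" by auto
      show "initial_wedge j * x \<in> S"
      proof (cases "i \<le> j")
        case True
        then show ?thesis using x
          by (simp add: mult.assoc[symmetric] initial_wedge_mult_eps pm.subspace_0[OF sub])
      next
        case False
        then show ?thesis using step[OF x(3), of "i - Suc j"] x by simp
      qed
    qed
  qed
qed

lemma initial_wedge_in_ext_power: "initial_wedge k \<in> ext_power k"
  using prod_in_ext_power[of "map \<epsilon> [1..<k + 1]" k]
  by (simp add: initial_wedge_def comp_def del: upt_Suc)

theorem proposition4p3:
  fixes k :: nat
  assumes "1 \<le> k" and "k \<le> CARD('n::finite)"
  shows "intersection_pair pscale (ext_power k :: 'n shift_module exterior set) D_ext \<and>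
    fundamental_element pscale (ext_power k :: 'n shift_module exterior set) D_ext
      (prod_list (map (\<lambda>i. \<iota> (\<epsilon> i)) [1..<k + 1]))"
proof -
  let ?N = "ext_power k :: 'n shift_module exterior set"
  have "?N \<subseteq> span_monomials pscale D_ext (initial_wedge k)"
    using initial_wedge_generates[of 0 k k] by (auto simp: initial_wedge_simps)
  then have "fundamental_element pscale ?N D_ext (initial_wedge k)"
    unfolding fundamental_element_def range_poly_op[OF module_pscale]
    using span_monomials_subset initial_wedge_in_ext_power by blast
  moreover have "\<forall>j. linear_endo_on pscale ?N (D_ext j)"
    by (auto simp: linear_endo_on_def D_ext_simps D_ext_closed)
  ultimately show ?thesis
    unfolding intersection_pair_def
    using hilbert_basis[OF noetherian_int] module_pscale free_ext_power D_ext_commute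
    by (auto simp: initial_wedge_def)
qed

end
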